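(* For all non-negative integers $u$ and $d$, $$q(u,d)=\binom{u+d}{u},$$ where $q(u,d)$ denotes the number of quantile pairs $(v,k)$ for which $v$ has exactly $u$ up-steps and $d$ down-steps.
   Context: Intervals $[a,b]$, $[a,b)$ denote intervals of integers. A simple walk of length $n$ is a function $v:[0,n]\to\mathbb Z$ with $v(0)=0$ and increments $v(i)-v(i-1)\in\{+1,-1\}$ (up-steps and down-steps). A quantile walk is a simple walk $v$ of some length $n$ that is either non-negative at all times in $[0,n]$ or a first-passage bridge to a negative value ($v(n)<0$ and $v(j)\neq v(n)$ for all $j<n$). A quantile pair is a pair $(v,k)$ where $v$ is a quantile walk of length $n$ and $k$ is an integer with $1\le k\le n$ (if $n=0$, the only allowed value is $k=0$) such that $v(j)\ge0$ for $j\in[0,k)$ and $v(j)>v(n)$ for $j\in[k,n)$. *)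

theory Defs
  imports Complex_Main "HOL-Library.FuncSet"
begin

text \<open>
  A function on the integer interval \<open>[0,n]\<close> is represented by a function on \<^typ>\<open>nat\<close> that is
  extensional on \<open>{0..n}\<close> (constantly \<^const>\<open>undefined\<close> outside), so that distinct walks of
  length \<open>n\<close> are distinct as HOL functions and can be counted by \<^const>\<open>card\<close>.
\<close>

definition simple_walk :: "nat \<Rightarrow> (nat \<Rightarrow> int) \<Rightarrow> bool" where
  "simple_walk n v \<longleftrightarrow>
     v \<in> {0..n} \<rightarrow>\<^sub>E (UNIV :: int set) \<and> v 0 = 0 \<and>
     (\<forall>i\<in>{1..n}. v i - v (i - 1) \<in> {1, -1})"

definition up_steps :: "nat \<Rightarrow> (nat \<Rightarrow> int) \<Rightarrow> nat" where
  "up_steps n v = card {i \<in> {1..n}. v i - v (i - 1) = 1}"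

definition down_steps :: "nat \<Rightarrow> (nat \<Rightarrow> int) \<Rightarrow> nat" where
  "down_steps n v = card {i \<in> {1..n}. v i - v (i - 1) = -1}"

definition neg_first_passage_bridge :: "nat \<Rightarrow> (nat \<Rightarrow> int) \<Rightarrow> bool" where
  "neg_first_passage_bridge n v \<longleftrightarrow> v n < 0 \<and> (\<forall>j<n. v j \<noteq> v n)"

definition quantile_walk :: "nat \<Rightarrow> (nat \<Rightarrow> int) \<Rightarrow> bool" where
  "quantile_walk n v \<longleftrightarrow>
     simple_walk n v \<and> ((\<forall>j\<in>{0..n}. 0 \<le> v j) \<or> neg_first_passage_bridge n v)"

definition quantile_pair :: "nat \<Rightarrow> (nat \<Rightarrow> int) \<Rightarrow> nat \<Rightarrow> bool" where
  "quantile_pair n v k \<longleftrightarrow>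
     quantile_walk n v \<and>
     (if n = 0 then k = 0 else 1 \<le> k \<and> k \<le> n) \<and>
     (\<forall>j\<in>{0..<k}. 0 \<le> v j) \<and> (\<forall>j\<in>{k..<n}. v n < v j)"

text \<open>
  The length \<open>n\<close> is part of the data of a walk (it is the domain of \<open>v\<close>), hence the set of triples.
\<close>

definition q :: "nat \<Rightarrow> nat \<Rightarrow> nat" where
  "q u d = card {(n, v, k). quantile_pair n v k \<and> up_steps n v = u \<and> down_steps n v = d}"

end

(* Write a quantile pair (v,k) as the pair of step words (xs, ys) of v on [0,k] and [k,n], and
   exchange the two blocks. In the rotated word ys @ xs the position n - k is then exactly the
   first time at which the rotated walk attains its minimum over [0,n). Every word has exactly
   one such time, so exchanging the blocks is a bijection onto all words with u up-steps and
   d down-steps. *)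
theory Submission
  imports Defs "HOL-Combinatorics.Multiset_Permutations"
begin

text \<open>The restriction makes the partial-sum function extensional, as
  \<open>simple_walk\<close> demands, so walks and words can be compared by plain equality.\<close>

definition walk_of :: "int list \<Rightarrow> nat \<Rightarrow> int" where
  "walk_of zs = restrict (\<lambda>i. sum_list (take i zs)) {0..length zs}"

lemma walk_of_eq: "i \<le> length zs \<Longrightarrow> walk_of zs i = sum_list (take i zs)"
  by (simp add: walk_of_def)

lemma walk_of_step: "i < length zs \<Longrightarrow> walk_of zs (Suc i) - walk_of zs i = zs ! i"
  by (simp add: walk_of_eq take_Suc_conv_app_nth)

lemma walk_of_inject:
  assumes "length xs = length ys" "walk_of xs = walk_of ys"
  shows "xs = ys"
  using assms by (intro nth_equalityI) (auto simp flip: walk_of_step)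

lemma simple_walk_iff:
  "simple_walk n v \<longleftrightarrow> (\<exists>zs. length zs = n \<and> set zs \<subseteq> {1, -1} \<and> v = walk_of zs)"
proof
  assume v: "simple_walk n v"
  \<comment> \<open>The letters are the increments of \<open>v\<close>; since
    \<open>v 0 = 0\<close>, their partial sums telescope back to \<open>v\<close>.\<close>
  define zs where "zs = map (\<lambda>i. v (Suc i) - v i) [0..<n]"
  have "sum_list (take i zs) = v i" if "i \<le> n" for i
    using that
  proof (induction i)
    case 0
    show ?case using v by (simp add: simple_walk_def)
  next
    case (Suc i)
    then show ?case by (simp add: take_Suc_conv_app_nth zs_def)
  qed
  then have "v = walk_of zs"
    using v by (auto simp: simple_walk_def walk_of_def zs_def PiE_def extensional_def fun_eq_iff)
  moreover have "set zs \<subseteq> {1, -1}"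
  proof
    fix z assume "z \<in> set zs"
    then obtain i where "i < n" "z = v (Suc i) - v (Suc i - 1)"
      by (auto simp: zs_def)
    moreover have "Suc i \<in> {1..n}" using \<open>i < n\<close> by simp
    ultimately show "z \<in> {1, -1}"
      using v unfolding simple_walk_def by blast
  qed
  ultimately show "\<exists>zs. length zs = n \<and> set zs \<subseteq> {1, -1} \<and> v = walk_of zs"
    by (intro exI[of _ zs]) (simp add: zs_def)
next
  assume "\<exists>zs. length zs = n \<and> set zs \<subseteq> {1, -1} \<and> v = walk_of zs"
  then obtain zs where zs: "length zs = n" "set zs \<subseteq> {1, -1}" "v = walk_of zs" by blast
  have "v i - v (i - 1) \<in> {1, -1}" if "i \<in> {1..n}" for i
  proof -
    from that obtain j where j: "i = Suc j" "j < n" by (cases i) auto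
    then have "v i - v (i - 1) = zs ! j" using walk_of_step[of j zs] zs by simp
    moreover have "zs ! j \<in> set zs" using j zs by simp
    ultimately show ?thesis using zs(2) by auto
  qed
  then show "simple_walk n v"
    by (auto simp: simple_walk_def zs walk_of_def)
qed

lemma card_steps_walk_of:
  "card {i \<in> {1..length zs}. walk_of zs i - walk_of zs (i - 1) = c} = count (mset zs) c"
proof -
  \<comment> \<open>The step arriving at time \<open>Suc i\<close> is the letter at list index
    \<open>i\<close>, hence the shift by \<open>Suc\<close>.\<close>
  have "{i \<in> {1..length zs}. walk_of zs i - walk_of zs (i - 1) = c}
      = Suc ` {i. i < length zs \<and> c = zs ! i}" (is "?L = ?R")
  proof (rule set_eqI)
    fix i show "i \<in> ?L \<longleftrightarrow> i \<in> ?R"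
      by (cases i) (auto simp: walk_of_step Suc_le_eq)
  qed
  then have "card ?L = length (filter ((=) c) zs)"
    by (simp add: card_image length_filter_conv_card)
  then show ?thesis
    by (simp add: count_mset count_list_eq_length_filter)
qed

text \<open>Here \<open>xs\<close> covers \<open>[0,k]\<close> and \<open>ys\<close> covers
  \<open>[k,n]\<close>. The implication encodes \<open>1 \<le> k\<close> unless
  \<open>n = 0\<close>. The bound \<open>j < length xs\<close> leaves the end of \<open>xs\<close>
  free; after the exchange this is the final time \<open>n\<close>, which does not compete for the
  minimum.\<close>

definition quantile_split :: "int list \<Rightarrow> int list \<Rightarrow> bool" where
  "quantile_split xs ys \<longleftrightarrow> (xs = [] \<longrightarrow> ys = []) \<and>
     (\<forall>j<length xs. 0 \<le> sum_list (take j xs)) \<and>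
     (\<forall>j<length ys. sum_list ys < sum_list (take j ys))"

text \<open>All heights from time \<open>k\<close> on share the summand \<open>sum_list xs\<close>.
  It cancels when they are compared with the final height, so each inequality concerns one block
  alone.\<close>

lemma quantile_pair_walk_of:
  assumes "set (xs @ ys) \<subseteq> {1, -1}"
  shows "quantile_pair (length (xs @ ys)) (walk_of (xs @ ys)) (length xs) \<longleftrightarrow> quantile_split xs ys"
proof -
  let ?v = "walk_of (xs @ ys)" and ?k = "length xs" and ?n = "length (xs @ ys)"
  have simple: "simple_walk ?n ?v"
    using assms unfolding simple_walk_iff by blast
  have first: "(\<forall>j\<in>{0..<?k}. 0 \<le> ?v j) \<longleftrightarrow> (\<forall>j<?k. 0 \<le> sum_list (take j xs))"
    by (auto simp: walk_of_eq)
  have shift: "?v (?k + j) = sum_list xs + sum_list (take j ys)" if "j \<le> length ys" for j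
    using that by (simp add: walk_of_eq)
  have "(\<forall>j\<in>{?k..<?n}. ?v ?n < ?v j) \<longleftrightarrow> (\<forall>j<length ys. ?v (?k + length ys) < ?v (?k + j))"
    (is "?A \<longleftrightarrow> ?B")
  proof
    assume ?B
    show ?A
    proof
      fix j assume "j \<in> {?k..<?n}"
      then show "?v ?n < ?v j" using \<open>?B\<close>[rule_format, of "j - ?k"] by auto
    qed
  qed auto
  then have second: "?A \<longleftrightarrow> (\<forall>j<length ys. sum_list ys < sum_list (take j ys))"
    by (simp add: shift)
  \<comment> \<open>If the final height is negative, the first block stays above it by being
    non-negative and the second by \<open>?A\<close>, so it is reached only at the end. Otherwise
    \<open>?A\<close> keeps the second block above a non-negative number, and the whole walk is
    non-negative.\<close>
  have quantile: "quantile_walk ?n ?v" if "\<forall>j\<in>{0..<?k}. 0 \<le> ?v j" ?A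
  proof (cases "?v ?n < 0")
    case True
    have "?v ?n < ?v j" if "j < ?n" for j
    proof (cases "j < ?k")
      case True
      then have "0 \<le> ?v j" using \<open>\<forall>j\<in>{0..<?k}. 0 \<le> ?v j\<close> by simp
      with \<open>?v ?n < 0\<close> show ?thesis by linarith
    next
      case False
      then show ?thesis using \<open>?A\<close> that by (meson atLeastLessThan_iff not_le)
    qed
    then show ?thesis
      using simple True unfolding quantile_walk_def neg_first_passage_bridge_def
      by (metis less_irrefl)
  next
    case False
    have "0 \<le> ?v j" if "j \<le> ?n" for j
    proof -
      consider "j < ?k" | "?k \<le> j" "j < ?n" | "j = ?n" using \<open>j \<le> ?n\<close> by linarith
      then show ?thesis
      proof cases
        case 2
        then have "?v ?n < ?v j" using \<open>?A\<close> by simp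
        with False show ?thesis by linarith
      qed (use False \<open>\<forall>j\<in>{0..<?k}. 0 \<le> ?v j\<close> in auto)
    qed
    then show ?thesis
      using simple by (simp add: quantile_walk_def)
  qed
  have "(if ?n = 0 then ?k = 0 else 1 \<le> ?k \<and> ?k \<le> ?n) \<longleftrightarrow> (xs = [] \<longrightarrow> ys = [])"
    by (cases xs) auto
  with first second quantile show ?thesis
    unfolding quantile_pair_def quantile_split_def by blast
qed

text \<open>Appending a letter turns the old final time into a new candidate for the minimum. Its
  height relative to the current minimum is \<open>sum_list xs\<close>: if this is non-negative, the
  old cut survives, ties favouring the earlier time; if it is negative, the cut moves to the end of
  \<open>zs\<close>.\<close>

lemma quantile_split_exists: "\<exists>xs ys. zs = ys @ xs \<and> quantile_split xs ys"
proof (induction zs rule: rev_induct)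
  case Nil
  show ?case by (simp add: quantile_split_def)
next
  case (snoc z zs)
  then obtain xs ys where zs: "zs = ys @ xs" and split: "quantile_split xs ys" by blast
  show ?case
  proof (cases "0 \<le> sum_list xs")
    case True
    have "quantile_split (xs @ [z]) ys"
      using split True by (auto simp: quantile_split_def less_Suc_eq)
    then show ?thesis using zs by auto
  next
    case False
    \<comment> \<open>The end of \<open>zs\<close> lies strictly below the end of \<open>ys\<close>,
      which in turn was a minimum over all times before the end of \<open>zs\<close>.\<close>
    have "sum_list zs < sum_list (take j zs)" if "j < length zs" for j
    proof (cases "j < length ys")
      case True
      then show ?thesis using split False zs by (force simp: quantile_split_def)
    next
      case False': False
      then have "j - length ys < length xs" using that zs by auto
      then have "0 \<le> sum_list (take (j - length ys) xs)"
        using split by (simp add: quantile_split_def)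
      then show ?thesis using False False' zs by simp
    qed
    then have "quantile_split [z] zs"
      by (simp add: quantile_split_def)
    then show ?thesis by blast
  qed
qed

text \<open>Let \<open>p\<close> be the segment between two distinct cuts. The earlier cut is at
  most as high as later times, so \<open>p\<close> has sum at least 0; the later cut is strictly
  below all earlier times, so \<open>p\<close> has negative sum.\<close>

lemma quantile_split_unique:
  assumes "quantile_split xs ys" "quantile_split xs' ys'" "ys @ xs = ys' @ xs'"
  shows "xs = xs' \<and> ys = ys'"
proof -
  have no_longer: "\<not> length ys < length ys'"
    if split: "quantile_split xs ys" and split': "quantile_split xs' ys'"
      and eq: "ys @ xs = ys' @ xs'"
    for xs ys xs' ys' :: "int list"
  proof
    assume less: "length ys < length ys'"
    then obtain p where p: "ys' = ys @ p" "xs = p @ xs'"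
      using eq by (auto simp: append_eq_append_conv2)
    \<comment> \<open>This puts the later cut strictly before the end of \<open>xs\<close>, within
      the range where the first split gives non-negativity.\<close>
    have "xs' \<noteq> []" using less split' by (auto simp: quantile_split_def)
    then have "length p < length xs" using p by simp
    then have "0 \<le> sum_list (take (length p) xs)"
      using split unfolding quantile_split_def by blast
    moreover have "sum_list ys' < sum_list (take (length ys) ys')"
      using split' less by (simp add: quantile_split_def)
    ultimately show False using p by simp
  qed
  have "length ys = length ys'"
    using no_longer[OF assms] no_longer[OF assms(2,1) assms(3)[symmetric]] by linarith
  then show ?thesis using assms(3) by simp
qed

lemma card_permutations_of_two_letters:
  assumes "a \<noteq> b"
  shows "card (permutations_of_multiset (replicate_mset u a + replicate_mset d b)) = (u + d) choose u"
proof -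
  let ?M = "replicate_mset u a + replicate_mset d b"
  \<comment> \<open>If \<open>u\<close> or \<open>d\<close> is 0, the letter missing from
    \<open>?M\<close> contributes the factor \<open>fact 0 = 1\<close>, so the product may run over
    both letters.\<close>
  have "(\<Prod>x\<in>set_mset ?M. fact (count ?M x)) = (\<Prod>x\<in>{a, b}. fact (count ?M x) :: nat)"
    by (rule prod.mono_neutral_left) (auto split: if_splits)
  then show ?thesis
    using assms by (simp add: card_permutations_of_multiset binomial_fact')
qed

lemma mset_eq_two_letters_iff:
  assumes "a \<noteq> b"
  shows "mset zs = replicate_mset u a + replicate_mset d b \<longleftrightarrow>
    set zs \<subseteq> {a, b} \<and> count (mset zs) a = u \<and> count (mset zs) b = d" (is "?L \<longleftrightarrow> ?R")
proof
  assume ?L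
  then have "set zs = set_mset (replicate_mset u a + replicate_mset d b)"
    by (metis set_mset_mset)
  with \<open>?L\<close> assms show ?R by (auto split: if_splits)
next
  assume ?R
  then have "count (mset zs) c = 0" if "c \<notin> {a, b}" for c
    using that by (metis count_eq_zero_iff set_mset_mset subsetD)
  with \<open>?R\<close> assms show ?L by (intro multiset_eqI) auto
qed

theorem proposition3p3:
  fixes u d :: nat
  shows "q u d = (u + d) choose u"
proof -
  let ?M = "replicate_mset u 1 + replicate_mset d (-1) :: int multiset"
  let ?T = "{(n, v, k). quantile_pair n v k \<and> up_steps n v = u \<and> down_steps n v = d}"
  let ?D = "{(xs, ys). quantile_split xs ys \<and> mset (xs @ ys) = ?M}"
  let ?f = "\<lambda>(xs, ys). (length (xs @ ys), walk_of (xs @ ys), length xs)"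
  \<comment> \<open>Prescribing both step counts of a word over 1 and -1 amounts to prescribing its
    multiset of letters, which exchanging blocks preserves.\<close>
  have M_iff: "mset zs = ?M \<longleftrightarrow> set zs \<subseteq> {1, -1} \<and>
      up_steps (length zs) (walk_of zs) = u \<and> down_steps (length zs) (walk_of zs) = d" for zs
    by (simp add: mset_eq_two_letters_iff up_steps_def down_steps_def
        card_steps_walk_of[simplified])
  have "inj_on ?f ?D"
  proof (rule inj_onI, clarify)
    fix xs ys xs' ys' :: "int list"
    assume eq: "length (xs @ ys) = length (xs' @ ys')" "walk_of (xs @ ys) = walk_of (xs' @ ys')"
      "length xs = length xs'"
    have "xs @ ys = xs' @ ys'" by (rule walk_of_inject) (fact eq)+
    then show "xs = xs' \<and> ys = ys'" using eq(3) by simp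
  qed
  moreover have "?f ` ?D = ?T"
  proof (intro equalityI subsetI)
    fix t assume "t \<in> ?f ` ?D"
    then obtain xs ys where t: "t = ?f (xs, ys)" and split: "quantile_split xs ys"
      and M: "mset (xs @ ys) = ?M" by auto
    have "quantile_pair (length (xs @ ys)) (walk_of (xs @ ys)) (length xs)"
      using quantile_pair_walk_of[of xs ys] split M M_iff by blast
    then show "t \<in> ?T" unfolding t using M[unfolded M_iff] by simp
  next
    fix t assume "t \<in> ?T"
    then obtain n v k where t: "t = (n, v, k)" and qp: "quantile_pair n v k"
      and steps: "up_steps n v = u" "down_steps n v = d" by auto
    have "simple_walk n v" and "k \<le> n"
      using qp by (auto simp: quantile_pair_def quantile_walk_def split: if_splits)
    then obtain zs where zs: "length zs = n" "set zs \<subseteq> {1, -1}" "v = walk_of zs"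
      by (auto simp: simple_walk_iff)
    \<comment> \<open>The preimage of a pair is its step word cut at time \<open>k\<close>.\<close>
    have eq: "t = ?f (take k zs, drop k zs)"
      using t zs \<open>k \<le> n\<close> by simp
    have "quantile_split (take k zs) (drop k zs)"
      using quantile_pair_walk_of[of "take k zs" "drop k zs"] qp zs \<open>k \<le> n\<close> by simp
    moreover have "mset (take k zs @ drop k zs) = ?M"
      using M_iff[of zs] steps zs by (simp only: append_take_drop_id)
    ultimately show "t \<in> ?f ` ?D" using eq by blast
  qed
  ultimately have "bij_betw ?f ?D ?T"
    by (rule bij_betw_imageI)
  then have "card ?T = card ?D"
    by (rule bij_betw_same_card[symmetric])
  \<comment> \<open>Injectivity is uniqueness of the cut, surjectivity its existence.\<close>
  moreover have "bij_betw (\<lambda>(xs, ys). ys @ xs) ?D (permutations_of_multiset ?M)"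
  proof (rule bij_betwI')
    fix p p' assume "p \<in> ?D" "p' \<in> ?D"
    then show "(case p of (xs, ys) \<Rightarrow> ys @ xs) = (case p' of (xs, ys) \<Rightarrow> ys @ xs) \<longleftrightarrow> p = p'"
      using quantile_split_unique by (auto split: prod.splits)
  next
    fix p assume "p \<in> ?D"
    then show "(case p of (xs, ys) \<Rightarrow> ys @ xs) \<in> permutations_of_multiset ?M"
      by (auto simp: permutations_of_multiset_def union_commute)
  next
    fix zs assume "zs \<in> permutations_of_multiset ?M"
    then have M: "mset zs = ?M" by (simp add: permutations_of_multiset_def)
    obtain xs ys where "zs = ys @ xs" "quantile_split xs ys"
      using quantile_split_exists by blast
    with M show "\<exists>p\<in>?D. zs = (case p of (xs, ys) \<Rightarrow> ys @ xs)"
      by (intro bexI[of _ "(xs, ys)"]) (simp_all add: union_commute)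
  qed
  then have "card ?D = card (permutations_of_multiset ?M)"
    by (rule bij_betw_same_card)
  moreover have "card (permutations_of_multiset ?M) = (u + d) choose u"
    by (rule card_permutations_of_two_letters) simp
  ultimately show ?thesis
    by (simp only: q_def)
qed

end
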